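(* The partially ordered sets $\mathscr{D}_{\mathrm{T2}}$ and $\mathscr{D}_{\mathrm{T3}}$ have all binary meets, and the embedding $\mathscr{D}_{\mathrm{T2}} \hookrightarrow \mathscr{D}_{\mathrm{T3}}$ preserves them. On the T2 level, an explicit construction is the following: for T2 oracles $f, g$ (partial functions from $\mathbb{N}$ to $\mathcal{P}(\mathbb{N})$), the meet of $[f]_{\mathrm{T2}}$ and $[g]_{\mathrm{T2}}$ is $[f \curlywedge_{\mathrm{T2}} g]_{\mathrm{T2}}$, where $f \curlywedge_{\mathrm{T2}} g$ is defined on $\langle m, n \rangle$ exactly when $f(m)$ and $g(n)$ both are, and is then equal to $f(m) \sqcup g(n)$. On the T3 level, for T3 oracles $f,g\colon\mathbb{N}\to\mathcal{P}(\mathcal{P}(\mathbb{N}))$, the meet of $[f]_{\mathrm{T3}}$ and $[g]_{\mathrm{T3}}$ is $[f \curlywedge_{\mathrm{T3}} g]_{\mathrm{T3}}$, where $(f \curlywedge_{\mathrm{T3}} g)(\langle m, n \rangle) := \{U \sqcup V \mid U \in f(m),\ V \in g(n)\}$ (and the value is $\varnothing$ at numbers not of the form $\langle m,n\rangle$, if any).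
   Context: Oracles. A T2 oracle is a partial function from $\mathbb{N}$ to $\mathcal{P}(\mathbb{N})$; a T3 oracle is a total function $\mathbb{N}\to\mathcal{P}(\mathcal{P}(\mathbb{N}))$. A T2 oracle $g$ is identified with the T3 oracle $n\mapsto\{g(n)\}$ if $g(n)$ is defined and $n\mapsto\varnothing$ otherwise. Reduction game of $f$ to $g$ (for T3 oracles $f,g$). Players Arthur and Nimue are allied against Merlin. The initial configuration is any $m\in\mathbb{N}$ together with a set $F\in f(m)$; Arthur sees only $m$, while Nimue and Merlin see both. Arthur, Nimue, Merlin then play in turn, repeatedly. At his turn Arthur either declares a final value $u\in\mathbb{N}$, ending the game (Arthur and Nimue win iff $u\in F$), or queries the oracle at some $n\in\mathbb{N}$. If $g(n)=\varnothing$, Arthur and Nimue lose immediately; otherwise Nimue chooses $G\in g(n)$ (seen by Merlin, not by Arthur). If $G=\varnothing$, Merlin loses immediately; otherwise Merlin chooses $v\in G$, which everyone sees, and it is Arthur's turn again. If the game never ends, Merlin wins. An Arthur strategy is a partial computable function taking $m$ and the finite sequence of Merlin's moves so far to Arthur's next move (if it is undefined or malformed, Arthur and Nimue lose); a Nimue strategy is an arbitrary function of the initial configuration and of all past moves of Arthur and Merlin. A pair of such strategies is winning if Arthur and Nimue win for every initial configuration and all moves of Merlin. One says $f$ is reducible to $g$ if a winning Arthur+Nimue strategy exists. This is a preorder; $\mathscr{D}_{\mathrm{T3}}$ (the T3 degrees) is the poset quotient, and $[f]_{\mathrm{T3}}$ is the class of $f$. $\mathscr{D}_{\mathrm{T2}}\subseteq\mathscr{D}_{\mathrm{T3}}$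 is the set of degrees of T2 oracles, with the induced order; $[f]_{\mathrm{T2}}$ is the degree of the T2 oracle $f$. $\langle m,n\rangle$ is a fixed computable (injective) coding of pairs by natural numbers, and $U \sqcup V := \{\langle 0, u \rangle \mid u \in U\} \cup \{\langle 1, v \rangle \mid v\in V\}$ for $U,V\subseteq\mathbb{N}$. *)

theory Defs
  imports "HOL-Algebra.Lattice" "HOL-Library.Nat_Bijection"
begin

section \<open>Partial computable functions\<close>

definition minimization :: "(nat \<rightharpoonup> nat) \<Rightarrow> (nat \<rightharpoonup> nat)" where
  "minimization f a =
    (let P = (\<lambda>n. f (prod_encode (a, n)) = Some 0 \<and>
                    (\<forall>k<n. \<exists>y. f (prod_encode (a, k)) = Some (Suc y)))
     in if \<exists>n. P n then Some (THE n. P n) else None)"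

text \<open>The partial recursive functions, presented as unary functions. Several arguments are passed
  through the Cantor pairing function \<^const>\<open>prod_encode\<close>, whose projections are therefore among
  the initial functions; the closure operations are tupling, composition, primitive recursion
  and unbounded minimization, all of them strict in undefined values.\<close>

inductive partial_recursive :: "(nat \<rightharpoonup> nat) \<Rightarrow> bool" where
  zero: "partial_recursive (\<lambda>x. Some 0)"
| succ: "partial_recursive (\<lambda>x. Some (Suc x))"
| left: "partial_recursive (\<lambda>x. Some (fst (prod_decode x)))"
| right: "partial_recursive (\<lambda>x. Some (snd (prod_decode x)))"
| pair: "partial_recursive f \<Longrightarrow> partial_recursive g \<Longrightarrow>
    partial_recursive (\<lambda>x. Option.bind (f x) (\<lambda>a. Option.bind (g x) (\<lambda>b. Some (prod_encode (a, b)))))"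
| comp: "partial_recursive f \<Longrightarrow> partial_recursive g \<Longrightarrow>
    partial_recursive (\<lambda>x. Option.bind (g x) f)"
| prec: "partial_recursive f \<Longrightarrow> partial_recursive g \<Longrightarrow>
    partial_recursive (\<lambda>x. case prod_decode x of (a, n) \<Rightarrow>
      rec_nat (f a) (\<lambda>y r. Option.bind r (\<lambda>i. g (prod_encode (a, prod_encode (y, i))))) n)"
| min: "partial_recursive f \<Longrightarrow> partial_recursive (minimization f)"

definition computable2 :: "(nat \<Rightarrow> nat \<Rightarrow> nat) \<Rightarrow> bool" where
  "computable2 h \<longleftrightarrow> partial_recursive (\<lambda>x. case prod_decode x of (a, b) \<Rightarrow> Some (h a b))"


section \<open>Oracles\<close>

type_synonym T2_oracle = "nat \<rightharpoonup> nat set"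
type_synonym T3_oracle = "nat \<Rightarrow> nat set set"

definition T3_of_T2 :: "T2_oracle \<Rightarrow> T3_oracle" where
  "T3_of_T2 g n = (case g n of None \<Rightarrow> {} | Some G \<Rightarrow> {G})"


section \<open>The reduction game\<close>

datatype arthur_move = Declare nat | Query nat

text \<open>An Arthur strategy maps \<open>m\<close> and the list of Merlin's moves so far (oldest first) to the code of
  Arthur's next move. Declaring \<open>u\<close> has code \<open>\<langle>0, u\<rangle>\<close>, querying \<open>n\<close> has code \<open>\<langle>1, n\<rangle>\<close>; all other
  codes are malformed.\<close>

type_synonym arthur_strategy = "nat \<Rightarrow> nat list \<rightharpoonup> nat"

definition decode_move :: "nat \<rightharpoonup> arthur_move" where
  "decode_move c = (case prod_decode c of (t, x) \<Rightarrow>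
     if t = 0 then Some (Declare x) else if t = 1 then Some (Query x) else None)"

definition arthur_computable :: "arthur_strategy \<Rightarrow> bool" where
  "arthur_computable \<alpha> \<longleftrightarrow>
    (\<exists>\<phi>. partial_recursive \<phi> \<and> (\<forall>m vs. \<alpha> m vs = \<phi> (prod_encode (m, list_encode vs))))"

definition arthur_plays :: "arthur_strategy \<Rightarrow> nat \<Rightarrow> nat list \<rightharpoonup> arthur_move" where
  "arthur_plays \<alpha> m vs = Option.bind (\<alpha> m vs) decode_move"

text \<open>A Nimue strategy is given the initial configuration \<open>m\<close>, \<open>F\<close>, the list of Arthur's moves
  (including the query she has to answer), and the list of Merlin's moves.\<close>

type_synonym nimue_strategy = "nat \<Rightarrow> nat set \<Rightarrow> arthur_move list \<Rightarrow> nat list \<Rightarrow> nat set"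

text \<open>Arthur's moves up to and including his reply to \<open>vs\<close>. When \<open>vs\<close> is a legal play and Arthur
  makes a well-formed move after it, no \<^const>\<open>the\<close> is applied to \<^const>\<open>None\<close>.\<close>

definition arthur_history :: "arthur_strategy \<Rightarrow> nat \<Rightarrow> nat list \<Rightarrow> arthur_move list" where
  "arthur_history \<alpha> m vs = map (\<lambda>i. the (arthur_plays \<alpha> m (take i vs))) [0..<Suc (length vs)]"

text \<open>Outcome of Arthur's and Nimue's turns after Merlin has played \<open>vs\<close>: the game has ended with
  Arthur and Nimue having won or lost, or Merlin has to choose an element of a nonempty set.
  Nimue loses by not answering with an element of \<open>g n\<close>, which includes the case \<open>g n = {}\<close>.\<close>

datatype status = Won | Lost | Merlin_to_choose "nat set"

definition status_after ::
    "T3_oracle \<Rightarrow> arthur_strategy \<Rightarrow> nimue_strategy \<Rightarrow> nat \<Rightarrow> nat set \<Rightarrow> nat list \<Rightarrow> status" where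
  "status_after g \<alpha> \<nu> m F vs =
    (case arthur_plays \<alpha> m vs of
       None \<Rightarrow> Lost
     | Some (Declare u) \<Rightarrow> if u \<in> F then Won else Lost
     | Some (Query n) \<Rightarrow>
         (let G = \<nu> m F (arthur_history \<alpha> m vs) vs
          in if G \<notin> g n then Lost else if G = {} then Won else Merlin_to_choose G))"

inductive legal_play ::
    "T3_oracle \<Rightarrow> arthur_strategy \<Rightarrow> nimue_strategy \<Rightarrow> nat \<Rightarrow> nat set \<Rightarrow> nat list \<Rightarrow> bool"
  for g \<alpha> \<nu> m F where
  start: "legal_play g \<alpha> \<nu> m F []"
| step: "legal_play g \<alpha> \<nu> m F vs \<Longrightarrow> status_after g \<alpha> \<nu> m F vs = Merlin_to_choose G \<Longrightarrow> v \<in> G \<Longrightarrow>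
    legal_play g \<alpha> \<nu> m F (vs @ [v])"

definition winning :: "T3_oracle \<Rightarrow> T3_oracle \<Rightarrow> arthur_strategy \<Rightarrow> nimue_strategy \<Rightarrow> bool" where
  "winning f g \<alpha> \<nu> \<longleftrightarrow> (\<forall>m. \<forall>F\<in>f m.
     (\<forall>vs. legal_play g \<alpha> \<nu> m F vs \<longrightarrow> status_after g \<alpha> \<nu> m F vs \<noteq> Lost) \<and>
     (\<nexists>w :: nat \<Rightarrow> nat. \<forall>k. legal_play g \<alpha> \<nu> m F (map w [0..<k])))"

definition T3_reducible :: "T3_oracle \<Rightarrow> T3_oracle \<Rightarrow> bool" where
  "T3_reducible f g \<longleftrightarrow> (\<exists>\<alpha> \<nu>. arthur_computable \<alpha> \<and> winning f g \<alpha> \<nu>)"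


section \<open>Degrees\<close>

definition T3_equiv :: "T3_oracle rel" where
  "T3_equiv = {(f, g). T3_reducible f g \<and> T3_reducible g f}"

definition T3_degree :: "T3_oracle \<Rightarrow> T3_oracle set" where
  "T3_degree f = T3_equiv `` {f}"

definition T2_degree :: "T2_oracle \<Rightarrow> T3_oracle set" where
  "T2_degree f = T3_degree (T3_of_T2 f)"

definition degree_le :: "T3_oracle set \<Rightarrow> T3_oracle set \<Rightarrow> bool" where
  "degree_le D E \<longleftrightarrow> (\<exists>f\<in>D. \<exists>g\<in>E. T3_reducible f g)"

definition D_T3 :: "T3_oracle set gorder" where
  "D_T3 = \<lparr>carrier = UNIV // T3_equiv, eq = (=), le = degree_le\<rparr>"

definition D_T2 :: "T3_oracle set gorder" where
  "D_T2 = \<lparr>carrier = range T2_degree, eq = (=), le = degree_le\<rparr>"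


section \<open>The explicit constructions\<close>

text \<open>The parameter \<open>pr\<close> is the coding of pairs.\<close>

definition tagged_union :: "(nat \<Rightarrow> nat \<Rightarrow> nat) \<Rightarrow> nat set \<Rightarrow> nat set \<Rightarrow> nat set" where
  "tagged_union pr U V = {pr 0 u | u. u \<in> U} \<union> {pr 1 v | v. v \<in> V}"

definition meet_T2 :: "(nat \<Rightarrow> nat \<Rightarrow> nat) \<Rightarrow> T2_oracle \<Rightarrow> T2_oracle \<Rightarrow> T2_oracle" where
  "meet_T2 pr f g k =
    (if k \<in> range (\<lambda>(m, n). pr m n) then
       (case inv (\<lambda>(m, n). pr m n) k of (m, n) \<Rightarrow>
          (case (f m, g n) of (Some U, Some V) \<Rightarrow> Some (tagged_union pr U V) | _ \<Rightarrow> None))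
     else None)"

definition meet_T3 :: "(nat \<Rightarrow> nat \<Rightarrow> nat) \<Rightarrow> T3_oracle \<Rightarrow> T3_oracle \<Rightarrow> T3_oracle" where
  "meet_T3 pr f g k = {tagged_union pr U V | m n U V. k = pr m n \<and> U \<in> f m \<and> V \<in> g n}"

end

theory Submission
  imports Defs
begin

text \<open>
  Why binary meets exist. A reduction of \<^term>\<open>h\<close> to the meet of \<^term>\<open>f\<close> and \<^term>\<open>g\<close> is obtained by
  running a reduction to \<^term>\<open>f\<close> and a reduction to \<^term>\<open>g\<close> side by side: when they are about to
  query \<open>m\<close> and \<open>n\<close>, Arthur queries \<open>pr m n\<close>, and if Nimue would answer \<open>U\<close> and \<open>V\<close>, she answers
  their tagged union. Merlin's reply carries a tag, so Arthur knows which of the two games it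
  advances; the other one just waits with the same pending query. As soon as one game declares a
  value, so does Arthur. Each reply shortens what remains of one of two games, both of which end,
  so the combined game ends (\<open>meet_T3_greatest\<close>). Conversely, one query to \<open>f\<close> or to \<open>g\<close>
  answers the meet, after tagging (\<open>meet_T3_lower\<close>). On T2 oracles, where Nimue never has a choice,
  the T3 construction is literally the T2 construction (\<open>meet_T3_of_T2\<close>), hence the T2 degrees are
  closed under the meets of the T3 degrees and inherit them.

  For degrees to be ordered at all, reducibility has to be transitive (\<open>T3_reducible_trans\<close>): Arthur
  answers each query of the outer game by playing a complete inner game.

  Two devices keep the proofs short. Nimue is eliminated: a winning pair of strategies exists exactly
  when the initial position lies in an inductively defined set \<open>forces\<close> of positions, and then
  statements on games become inductions over \<open>forces\<close> (\<open>T3_reducible_iff_forces\<close>). And since an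
  Arthur strategy is a function of Merlin's moves alone, a strategy for a combined game is a program
  that reads these moves from left to right and rebuilds from them the positions of the two component
  games (\<open>replay\<close>). Its computability rests on a loop operator \<open>run\<close> for partial recursive functions.
\<close>

section \<open>A calculus of partial recursive functions\<close>

abbreviation pair_code :: "nat \<Rightarrow> nat \<Rightarrow> nat" (\<open>\<langle>_,/ _\<rangle>\<close>) where
  "\<langle>a, b\<rangle> \<equiv> prod_encode (a, b)"

abbreviation code_fst :: "nat \<Rightarrow> nat" where "code_fst x \<equiv> fst (prod_decode x)"
abbreviation code_snd :: "nat \<Rightarrow> nat" where "code_snd x \<equiv> snd (prod_decode x)"

definition recursive :: "(nat \<Rightarrow> nat) \<Rightarrow> bool" where
  "recursive f \<longleftrightarrow> partial_recursive (\<lambda>x. Some (f x))"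

lemma recursive_id: "recursive (\<lambda>x. x)"
  using partial_recursive.pair[OF partial_recursive.left partial_recursive.right]
  by (simp add: recursive_def)

lemma partial_recursive_comp: "partial_recursive p \<Longrightarrow> recursive f \<Longrightarrow> partial_recursive (\<lambda>x. p (f x))"
  using partial_recursive.comp[of p "\<lambda>x. Some (f x)"] by (simp add: recursive_def)

lemma recursive_comp: "recursive h \<Longrightarrow> recursive f \<Longrightarrow> recursive (\<lambda>x. h (f x))"
  unfolding recursive_def[of h] recursive_def[of "\<lambda>x. h (f x)"] by (rule partial_recursive_comp)

lemma recursive_pair: "recursive f \<Longrightarrow> recursive g \<Longrightarrow> recursive (\<lambda>x. \<langle>f x, g x\<rangle>)"
  using partial_recursive.pair[of "\<lambda>x. Some (f x)" "\<lambda>x. Some (g x)"] by (simp add: recursive_def)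

lemma recursive_fst: "recursive f \<Longrightarrow> recursive (\<lambda>x. code_fst (f x))"
  using recursive_comp[of code_fst f] partial_recursive.left by (simp add: recursive_def)

lemma recursive_snd: "recursive f \<Longrightarrow> recursive (\<lambda>x. code_snd (f x))"
  using recursive_comp[of code_snd f] partial_recursive.right by (simp add: recursive_def)

lemma recursive_Suc: "recursive f \<Longrightarrow> recursive (\<lambda>x. Suc (f x))"
  using recursive_comp[of Suc f] partial_recursive.succ by (simp add: recursive_def)

lemma recursive_const: "recursive (\<lambda>x. n)"
proof (induction n)
  case 0
  show ?case using partial_recursive.zero by (simp add: recursive_def)
next
  case (Suc n)
  then show ?case by (rule recursive_Suc)
qed

lemma recursive_pred: "recursive f \<Longrightarrow> recursive (\<lambda>x. f x - 1)"
proof -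
  assume f: "recursive f"
  have "recursive (\<lambda>x. code_fst (code_snd x))"
    by (intro recursive_fst recursive_snd recursive_id)
  then have "partial_recursive (\<lambda>x. case prod_decode x of (a, n) \<Rightarrow>
      rec_nat (Some 0) (\<lambda>y r. Option.bind r (\<lambda>i. Some (code_fst (code_snd \<langle>a, \<langle>y, i\<rangle>\<rangle>)))) n)"
    (is "partial_recursive ?p")
    unfolding recursive_def by (rule partial_recursive.prec[OF partial_recursive.zero])
  moreover have "rec_nat (Some 0) (\<lambda>y r. Option.bind r (\<lambda>i. Some y)) n = Some (n - 1)" for n :: nat
    by (induction n) auto
  ultimately have "recursive (\<lambda>x. code_snd x - 1)"
    by (simp add: recursive_def case_prod_beta)
  from recursive_comp[OF this recursive_pair[OF f f]] show ?thesis by simp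
qed

lemma recursive_diff: "recursive f \<Longrightarrow> recursive g \<Longrightarrow> recursive (\<lambda>x. f x - g x)"
proof -
  assume fg: "recursive f" "recursive g"
  have "recursive (\<lambda>x. code_snd (code_snd x) - 1)"
    by (intro recursive_snd recursive_pred recursive_id)
  then have "partial_recursive (\<lambda>x. case prod_decode x of (a, n) \<Rightarrow>
      rec_nat (Some a) (\<lambda>y r. Option.bind r (\<lambda>i. Some (code_snd (code_snd \<langle>a, \<langle>y, i\<rangle>\<rangle>) - 1))) n)"
    unfolding recursive_def
    by (rule partial_recursive.prec[OF recursive_id[unfolded recursive_def]])
  moreover have "rec_nat (Some a) (\<lambda>y r. Option.bind r (\<lambda>i. Some (i - 1))) n = Some (a - n)"
    for a n :: nat
    by (induction n) auto
  ultimately have "recursive (\<lambda>x. code_fst x - code_snd x)"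
    by (simp add: recursive_def case_prod_beta)
  from recursive_comp[OF this recursive_pair[OF fg]] show ?thesis by simp
qed

text \<open>Primitive recursion over \<^term>\<open>c x\<close>: the initial value is one branch, and every step replaces it
  by the other branch. The same recursion serves for the guard below.\<close>

lemma recursive_if:
  assumes "recursive c" "recursive f" "recursive g"
  shows "recursive (\<lambda>x. if c x = 0 then f x else g x)"
proof -
  have "recursive (\<lambda>z. g (code_fst z))"
    by (intro recursive_comp[OF assms(3)] recursive_fst recursive_id)
  then have "partial_recursive (\<lambda>x. case prod_decode x of (a, n) \<Rightarrow>
      rec_nat (Some (f a)) (\<lambda>y r. Option.bind r (\<lambda>i. Some (g (code_fst \<langle>a, \<langle>y, i\<rangle>\<rangle>)))) n)"
    unfolding recursive_def
    by (rule partial_recursive.prec[OF assms(2)[unfolded recursive_def]])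
  moreover have "rec_nat (Some (f a)) (\<lambda>y r. Option.bind r (\<lambda>i. Some (g a))) n
      = Some (if n = 0 then f a else g a)" for a n :: nat
    by (induction n) auto
  ultimately have "recursive (\<lambda>x. if code_snd x = 0 then f (code_fst x) else g (code_fst x))"
    by (simp add: recursive_def case_prod_beta)
  from recursive_comp[OF this recursive_pair[OF recursive_id assms(1)]] show ?thesis
    by (simp cong: if_cong)
qed

text \<open>The bound value is kept beside the input in a pair, so that the rules apply below binders, too.\<close>

lemma partial_recursive_bind:
  assumes "partial_recursive f" and "partial_recursive (\<lambda>z. g (code_fst z) (code_snd z))"
  shows "partial_recursive (\<lambda>x. Option.bind (f x) (g x))"
  using partial_recursive.comp[OF assms(2)
      partial_recursive.pair[OF recursive_id[unfolded recursive_def] assms(1)]]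
  by (simp add: Option.bind_assoc)

text \<open>Recursion is strict in its initial value, so a branch that may diverge must not be placed there;
  in the step function it is evaluated only if at least one step is made.\<close>

lemma partial_recursive_guard:
  assumes "recursive c" "partial_recursive f"
  shows "partial_recursive (\<lambda>x. if c x = 0 then Some 0 else f x)"
proof -
  have "partial_recursive (\<lambda>z. f (code_fst z))"
    by (intro partial_recursive_comp[OF assms(2)] recursive_fst recursive_id)
  then have "partial_recursive (\<lambda>x. case prod_decode x of (a, n) \<Rightarrow>
      rec_nat (Some 0) (\<lambda>y r. Option.bind r (\<lambda>i. f (code_fst \<langle>a, \<langle>y, i\<rangle>\<rangle>))) n)"
    by (rule partial_recursive.prec[OF partial_recursive.zero])
  moreover have "rec_nat (Some 0) (\<lambda>y r. Option.bind r (\<lambda>i. f a)) n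
      = (if n = 0 then Some 0 else f a)" for a n :: nat
    by (induction n) (auto simp: bind_eq_None_conv split: Option.bind_splits)
  ultimately have "partial_recursive (\<lambda>x. if code_snd x = 0 then Some 0 else f (code_fst x))"
    by (simp add: case_prod_beta)
  from partial_recursive_comp[OF this recursive_pair[OF recursive_id assms(1)]] show ?thesis
    by (simp cong: if_cong)
qed

text \<open>The conditional is lazy: \<^term>\<open>f x\<close> may be undefined where \<^term>\<open>g x\<close> is selected, and vice versa.
  Both branches are guarded, by complementary conditions, before the selection is made. Simulated
  strategies need this, since they may diverge on positions that do not occur in a play.\<close>

lemma partial_recursive_if:
  assumes c: "recursive c" and f: "partial_recursive f" and g: "partial_recursive g"
  shows "partial_recursive (\<lambda>x. if c x = 0 then f x else g x)"
proof -
  let ?nc = "\<lambda>x. if c x = 0 then 1 else 0 :: nat"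
  have nc: "recursive ?nc" by (intro recursive_if c recursive_const)
  have "recursive (\<lambda>z. if c (code_fst (code_fst z)) = 0 then code_snd (code_fst z) else code_snd z)"
    by (intro recursive_if recursive_comp[OF c] recursive_fst recursive_snd recursive_id)
  then have "partial_recursive (\<lambda>x. Option.bind (if ?nc x = 0 then Some 0 else f x)
      (\<lambda>a. Option.bind (if c x = 0 then Some 0 else g x) (\<lambda>b. Some (if c x = 0 then a else b))))"
    by (intro partial_recursive_bind partial_recursive_guard nc f
        partial_recursive_comp[OF partial_recursive_guard[OF c g]] recursive_fst recursive_id)
       (simp add: recursive_def)
  moreover have "(\<lambda>x. Option.bind (if ?nc x = 0 then Some 0 else f x)
      (\<lambda>a. Option.bind (if c x = 0 then Some 0 else g x) (\<lambda>b. Some (if c x = 0 then a else b))))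
    = (\<lambda>x. if c x = 0 then f x else g x)"
    by (rule ext) simp
  ultimately show ?thesis by (simp only:)
qed

lemma partial_recursive_Some: "recursive f \<Longrightarrow> partial_recursive (\<lambda>x. Some (f x))"
  by (simp add: recursive_def)

lemmas recursive_intros = recursive_id recursive_const recursive_pair recursive_fst recursive_snd
  recursive_Suc recursive_pred recursive_diff recursive_if
  partial_recursive_Some partial_recursive_bind partial_recursive_if

text \<open>This form avoids the definite description in the definition of minimization, and lets two
  searches be compared through the values they find.\<close>

lemma minimization_eq_Some_iff:
  "minimization f a = Some n \<longleftrightarrow>
    f \<langle>a, n\<rangle> = Some 0 \<and> (\<forall>k<n. \<exists>y. f \<langle>a, k\<rangle> = Some (Suc y))" (is "_ \<longleftrightarrow> ?P n")
proof -
  have unique: "n' = n" if "?P n'" "?P n" for n n'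
    using that by (metis Zero_not_Suc linorder_neqE_nat option.inject)
  have the: "(THE n'. ?P n') = n" if "?P n" for n
    using that unique by (intro the_equality) blast+
  show ?thesis
  proof (cases "\<exists>n'. ?P n'")
    case True
    then obtain n' where n': "?P n'" ..
    then have "minimization f a = Some n'"
      unfolding minimization_def Let_def using the[OF n'] by (simp only: if_P[OF True])
    then show ?thesis using n' unique by auto
  next
    case False
    then have "minimization f a = None"
      unfolding minimization_def Let_def by (simp only: if_not_P if_False)
    then show ?thesis using False by auto
  qed
qed

section \<open>Loops\<close>

definition iterate :: "(nat \<rightharpoonup> nat) \<Rightarrow> nat \<Rightarrow> nat \<rightharpoonup> nat" where
  "iterate g x n = rec_nat (Some x) (\<lambda>_ r. Option.bind r g) n"

lemma iterate_0 [simp]: "iterate g x 0 = Some x"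
  by (simp add: iterate_def)

lemma iterate_Suc: "iterate g x (Suc n) = Option.bind (g x) (\<lambda>y. iterate g y n)"
proof (induction n)
  case 0
  show ?case by (simp add: iterate_def)
next
  case (Suc n)
  have "iterate g x (Suc (Suc n)) = Option.bind (iterate g x (Suc n)) g"
    by (simp add: iterate_def)
  also have "\<dots> = Option.bind (g x) (\<lambda>y. Option.bind (iterate g y n) g)"
    by (simp add: Suc.IH)
  finally show ?case by (simp add: iterate_def)
qed

text \<open>The loop repeats \<^term>\<open>g\<close> until the state has first component \<open>0\<close>, and returns its second component.
  Strictness of the minimization does no harm: the iterates of \<^term>\<open>g\<close> are computed one after the
  other, and if one of them is undefined then so are all later ones.\<close>

definition run :: "(nat \<rightharpoonup> nat) \<Rightarrow> nat \<rightharpoonup> nat" where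
  "run g x = Option.bind
     (minimization (\<lambda>z. Option.bind (iterate g (code_fst z) (code_snd z)) (\<lambda>y. Some (code_fst y))) x)
     (\<lambda>n. Option.bind (iterate g x n) (\<lambda>y. Some (code_snd y)))"

lemma partial_recursive_run:
  assumes "partial_recursive g"
  shows "partial_recursive (run g)"
proof -
  have "partial_recursive (\<lambda>z. g (code_snd (code_snd z)))"
    by (intro partial_recursive_comp[OF assms] recursive_intros)
  from partial_recursive.prec[OF recursive_id[unfolded recursive_def] this]
  have it: "partial_recursive (\<lambda>z. iterate g (code_fst z) (code_snd z))"
    by (simp add: iterate_def case_prod_beta)
  have "partial_recursive (\<lambda>x. Option.bind
     (minimization (\<lambda>z. Option.bind (iterate g (code_fst z) (code_snd z)) (\<lambda>y. Some (code_fst y))) x)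
     (\<lambda>n. Option.bind (iterate g x n) (\<lambda>y. Some (code_snd y))))"
    by (intro partial_recursive_bind partial_recursive.min it recursive_intros)
  then show ?thesis
    by (simp add: run_def[abs_def])
qed

lemma run_halt [simp]: "run g \<langle>0, out\<rangle> = Some out"
proof -
  let ?f = "\<lambda>z. Option.bind (iterate g (code_fst z) (code_snd z)) (\<lambda>y. Some (code_fst y))"
  have "minimization ?f \<langle>0, out\<rangle> = Some 0"
    by (simp add: minimization_eq_Some_iff)
  then show ?thesis by (simp add: run_def)
qed

text \<open>With \<open>run_halt\<close>, this equation determines the values of the loop; no later proof looks at the iterates.\<close>

lemma run_step:
  assumes "code_fst x \<noteq> 0"
  shows "run g x = Option.bind (g x) (run g)"
proof -
  let ?f = "\<lambda>z. Option.bind (iterate g (code_fst z) (code_snd z)) (\<lambda>y. Some (code_fst y))"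
  have pos: "\<exists>n'. n = Suc n' \<and> iterate g x n \<noteq> None" if "minimization ?f x = Some n" for n
    using that assms by (cases n) (auto simp: minimization_eq_Some_iff split: Option.bind_splits)
  show ?thesis
  proof (cases "g x")
    case None
    then have "minimization ?f x = None"
      using pos by (cases "minimization ?f x") (auto simp: iterate_Suc)
    then show ?thesis by (simp add: run_def None)
  next
    case (Some y)
    have "minimization ?f x = Some (Suc n) \<longleftrightarrow> minimization ?f y = Some n" for n
      using assms by (simp add: minimization_eq_Some_iff iterate_Suc Some All_less_Suc2 gr0_conv_Suc)
    then have "minimization ?f x = map_option Suc (minimization ?f y)"
      using pos by (cases "minimization ?f x"; cases "minimization ?f y") fastforce+
    then show ?thesis
      by (cases "minimization ?f y") (simp_all add: run_def Some iterate_Suc)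
  qed
qed

section \<open>List codes\<close>

abbreviation code_hd :: "nat \<Rightarrow> nat" where "code_hd l \<equiv> code_fst (l - 1)"
abbreviation code_tl :: "nat \<Rightarrow> nat" where "code_tl l \<equiv> code_snd (l - 1)"
abbreviation code_rev :: "nat \<Rightarrow> nat" where "code_rev l \<equiv> list_encode (rev (list_decode l))"

text \<open>Codes of lists grow at the front, whereas moves are appended at the end.\<close>

definition code_snoc :: "nat \<Rightarrow> nat \<Rightarrow> nat" where
  "code_snoc l v = list_encode (list_decode l @ [v])"

lemma list_encode_eq_0_iff [simp]: "list_encode l = 0 \<longleftrightarrow> l = []"
  by (cases l) auto

text \<open>Reversal moves the entries of the list one by one to an accumulator.\<close>

lemma recursive_code_rev:
  assumes "recursive f"
  shows "recursive (\<lambda>x. code_rev (f x))"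
proof -
  let ?step = "\<lambda>x. let a = code_fst (code_snd x); l = code_snd (code_snd x) in
    Some (if l = 0 then \<langle>0, a\<rangle> else \<langle>1, \<langle>Suc \<langle>code_hd l, a\<rangle>, code_tl l\<rangle>\<rangle>)"
  have run: "run ?step \<langle>1, \<langle>list_encode a, list_encode l\<rangle>\<rangle> = Some (list_encode (rev l @ a))" for a l
  proof (induction l arbitrary: a)
    case Nil
    show ?case by (simp add: run_step)
  next
    case (Cons v l)
    show ?case using Cons.IH[of "v # a"] by (subst run_step) simp_all
  qed
  have "partial_recursive ?step"
    unfolding Let_def by (intro recursive_intros)
  then have "partial_recursive (\<lambda>x. run ?step \<langle>1, \<langle>0, f x\<rangle>\<rangle>)"
    by (intro partial_recursive_comp[OF partial_recursive_run] recursive_intros assms)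
  moreover have "run ?step \<langle>1, \<langle>0, l\<rangle>\<rangle> = Some (code_rev l)" for l
    using run[of "[]" "list_decode l"] by simp
  ultimately show ?thesis by (simp add: recursive_def)
qed

lemma recursive_code_snoc:
  assumes "recursive f" "recursive g"
  shows "recursive (\<lambda>x. code_snoc (f x) (g x))"
proof -
  have "recursive (\<lambda>x. code_rev (Suc \<langle>g x, code_rev (f x)\<rangle>))"
    by (intro recursive_code_rev recursive_intros assms)
  then show ?thesis by (simp add: code_snoc_def)
qed

section \<open>Inverting a computable pairing\<close>

lemma recursive_computable2:
  assumes "computable2 h" "recursive f" "recursive g"
  shows "recursive (\<lambda>x. h (f x) (g x))"
proof -
  have "recursive (\<lambda>x. h (code_fst x) (code_snd x))"
    using assms(1) by (simp add: computable2_def recursive_def case_prod_beta)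
  from recursive_comp[OF this recursive_pair[OF assms(2,3)]] show ?thesis by simp
qed

text \<open>Search for the code of the pair. The search diverges outside the range of \<^term>\<open>pr\<close>, but it
  only matters for Merlin's answers to a meet oracle and for numbers at which a meet oracle is not
  empty, and all of these lie in the range.\<close>

lemma unpairing:
  assumes inj: "inj (\<lambda>(m, n). pr m n)" and comp: "computable2 pr"
  obtains p where "partial_recursive p" and "\<And>m n. p (pr m n) = Some \<langle>m, n\<rangle>"
proof
  let ?pr = "\<lambda>x. pr (code_fst x) (code_snd x)"
  \<comment> \<open>Truncated subtraction: both differences vanish only if the numbers are equal.\<close>
  define t where "t z = (let v = code_fst z; w = ?pr (code_snd z) in if v - w = 0 then w - v else 1)"
    for z
  have "recursive t"
    unfolding t_def Let_def by (intro recursive_computable2[OF comp] recursive_intros)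
  then show "partial_recursive (minimization (\<lambda>z. Some (t z)))"
    unfolding recursive_def by (rule partial_recursive.min)
  fix m n
  have "?pr k = pr m n \<longleftrightarrow> prod_decode k = (m, n)" for k
    using inj_eq[OF inj, of "prod_decode k" "(m, n)"] by (simp add: case_prod_beta)
  then have "?pr k = pr m n \<longleftrightarrow> k = \<langle>m, n\<rangle>" for k
    by (metis prod_decode_inverse prod_encode_inverse)
  then have t: "t \<langle>pr m n, k\<rangle> = 0 \<longleftrightarrow> k = \<langle>m, n\<rangle>" for k
    unfolding t_def Let_def by auto
  have "\<exists>y. t \<langle>pr m n, k\<rangle> = Suc y" if "k < \<langle>m, n\<rangle>" for k
    using t[of k] that not0_implies_Suc by blast
  then show "minimization (\<lambda>z. Some (t z)) (pr m n) = Some \<langle>m, n\<rangle>"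
    by (simp add: minimization_eq_Some_iff t)
qed

section \<open>Forcing a win\<close>

text \<open>The positions, given by Merlin's moves, from which Nimue can make Arthur win. In \<open>ask\<close> the set
  \<^term>\<open>G\<close> is her answer; if it is empty there is no successor position and Merlin has lost. Being a
  least fixed point, the predicate also says that the game ends.\<close>

inductive forces :: "T3_oracle \<Rightarrow> arthur_strategy \<Rightarrow> nat \<Rightarrow> nat set \<Rightarrow> nat list \<Rightarrow> bool"
  for g \<alpha> m F where
  final: "arthur_plays \<alpha> m vs = Some (Declare u) \<Longrightarrow> u \<in> F \<Longrightarrow> forces g \<alpha> m F vs"
| ask: "arthur_plays \<alpha> m vs = Some (Query n) \<Longrightarrow> G \<in> g n \<Longrightarrow>
    (\<And>v. v \<in> G \<Longrightarrow> forces g \<alpha> m F (vs @ [v])) \<Longrightarrow> forces g \<alpha> m F vs"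

text \<open>If the initial position were outside \<^const>\<open>forces\<close>, Merlin could stay outside: against the answer
  of the given Nimue strategy there is always a move to another such position. This is an infinite
  legal play, which contradicts that the strategies win.\<close>

lemma winning_imp_forces:
  assumes win: "winning f g \<alpha> \<nu>" and F: "F \<in> f m"
  shows "forces g \<alpha> m F []"
proof (rule ccontr)
  assume not: "\<not> forces g \<alpha> m F []"
  let ?bad = "\<lambda>vs. legal_play g \<alpha> \<nu> m F vs \<and> \<not> forces g \<alpha> m F vs"
  have bad_next: "\<exists>v. ?bad (vs @ [v])" if bad: "?bad vs" for vs
  proof -
    have ok: "status_after g \<alpha> \<nu> m F vs \<noteq> Lost"
      using win F bad by (auto simp: winning_def)
    show ?thesis
    proof (cases "arthur_plays \<alpha> m vs")
      case None
      then show ?thesis using ok by (simp add: status_after_def)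
    next
      case (Some a)
      show ?thesis
      proof (cases a)
        case (Declare u)
        then show ?thesis
          using ok bad Some by (auto simp: status_after_def intro: forces.final split: if_splits)
      next
        case (Query n)
        define G where "G = \<nu> m F (arthur_history \<alpha> m vs) vs"
        have G: "G \<in> g n"
          using ok Some Query by (auto simp: status_after_def G_def Let_def split: if_splits)
        with bad Some Query obtain v where v: "v \<in> G" "\<not> forces g \<alpha> m F (vs @ [v])"
          using forces.ask by metis
        then have "status_after g \<alpha> \<nu> m F vs = Merlin_to_choose G"
          using G Some Query by (auto simp: status_after_def G_def Let_def)
        then show ?thesis
          using v bad legal_play.step by blast
      qed
    qed
  qed
  define pick where "pick vs = (SOME v. ?bad (vs @ [v]))" for vs
  \<comment> \<open>\<open>play k\<close> is the finite play after \<open>k\<close> moves; the infinite play consists of the moves picked at these.\<close>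
  define play where "play k = ((\<lambda>vs. vs @ [pick vs]) ^^ k) []" for k
  have bad: "?bad (play k)" for k
  proof (induction k)
    case 0
    show ?case using not by (simp add: play_def legal_play.start)
  next
    case (Suc k)
    from someI_ex[OF bad_next[OF this]] show ?case
      by (simp add: play_def pick_def)
  qed
  have "play k = map (\<lambda>i. pick (play i)) [0..<k]" for k
    by (induction k) (simp_all add: play_def)
  then have "\<forall>k. legal_play g \<alpha> \<nu> m F (map (\<lambda>i. pick (play i)) [0..<k])"
    using bad by metis
  then show False
    using win F unfolding winning_def by blast
qed

text \<open>Nimue must not answer with just any set whose elements all lead to \<^const>\<open>forces\<close>: choosing anew at
  each position could postpone the win for ever. Her choices have to come from one derivation, and
  this predicate fixes them as a function of Merlin's moves.\<close>

inductive forces_with ::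
    "(nat list \<Rightarrow> nat set) \<Rightarrow> T3_oracle \<Rightarrow> arthur_strategy \<Rightarrow> nat \<Rightarrow> nat set \<Rightarrow> nat list \<Rightarrow> bool"
  for \<sigma> g \<alpha> m F where
  final: "arthur_plays \<alpha> m vs = Some (Declare u) \<Longrightarrow> u \<in> F \<Longrightarrow> forces_with \<sigma> g \<alpha> m F vs"
| ask: "arthur_plays \<alpha> m vs = Some (Query n) \<Longrightarrow> \<sigma> vs \<in> g n \<Longrightarrow>
    (\<And>v. v \<in> \<sigma> vs \<Longrightarrow> forces_with \<sigma> g \<alpha> m F (vs @ [v])) \<Longrightarrow> forces_with \<sigma> g \<alpha> m F vs"

lemma forces_with_cong:
  assumes "forces_with \<sigma> g \<alpha> m F vs" and "\<And>ws. \<tau> (vs @ ws) = \<sigma> (vs @ ws)"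
  shows "forces_with \<tau> g \<alpha> m F vs"
  using assms
proof induction
  case (final vs u)
  then show ?case by (simp add: forces_with.final)
next
  case (ask vs n)
  have eq: "\<tau> vs = \<sigma> vs" using ask.prems[of "[]"] by simp
  show ?case
  proof (rule forces_with.ask)
    show "arthur_plays \<alpha> m vs = Some (Query n)" by fact
    show "\<tau> vs \<in> g n" using ask.hyps(2) eq by (simp only:)
    fix v
    assume "v \<in> \<tau> vs"
    then have "v \<in> \<sigma> vs" using eq by (simp only:)
    then show "forces_with \<tau> g \<alpha> m F (vs @ [v])"
    proof (rule ask.IH)
      show "\<tau> ((vs @ [v]) @ ws) = \<sigma> ((vs @ [v]) @ ws)" for ws
        using ask.prems[of "v # ws"] by (simp only: append.assoc append_Cons append_Nil)
    qed
  qed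
qed

text \<open>By induction every reply \<open>v\<close> of Merlin has its own choice function. They are glued by looking up
  in a longer play which reply was given; no conflict can arise, because the plays that extend
  different replies are disjoint.\<close>

lemma forces_imp_forces_with:
  assumes "forces g \<alpha> m F vs"
  shows "\<exists>\<sigma>. forces_with \<sigma> g \<alpha> m F vs"
  using assms
proof induction
  case (final vs u)
  then show ?case using forces_with.final by blast
next
  case (ask vs n G)
  then obtain \<sigma> where \<sigma>: "\<And>v. v \<in> G \<Longrightarrow> forces_with (\<sigma> v) g \<alpha> m F (vs @ [v])"
    by metis
  define \<tau> where "\<tau> ws = (if ws = vs then G else \<sigma> (ws ! length vs) ws)" for ws
  have "forces_with \<tau> g \<alpha> m F (vs @ [v])" if "v \<in> G" for v
    by (rule forces_with_cong[OF \<sigma>[OF that]]) (simp add: \<tau>_def nth_append)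
  moreover have "\<tau> vs = G" by (simp add: \<tau>_def)
  ultimately show ?case
    using forces_with.ask[of \<alpha> m vs n \<tau> g F] ask.hyps by blast
qed

lemma forces_imp_winning:
  assumes forces: "\<And>m F. F \<in> f m \<Longrightarrow> forces g \<alpha> m F []"
  shows "\<exists>\<nu>. winning f g \<alpha> \<nu>"
proof -
  have "\<exists>\<sigma>. F \<in> f m \<longrightarrow> forces_with \<sigma> g \<alpha> m F []" for m F
    using forces_imp_forces_with[OF forces] by blast
  then have "\<forall>m F. \<exists>\<sigma>. F \<in> f m \<longrightarrow> forces_with \<sigma> g \<alpha> m F []"
    by blast
  then obtain \<sigma> where \<sigma>: "\<And>m F. F \<in> f m \<Longrightarrow> forces_with (\<sigma> m F) g \<alpha> m F []"
    unfolding choice_iff by (elim exE) (rule that, blast)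
  define \<nu> :: nimue_strategy where "\<nu> = (\<lambda>m F as vs. \<sigma> m F vs)"
  have status: "status_after g \<alpha> \<nu> m F vs \<noteq> Lost"
    "status_after g \<alpha> \<nu> m F vs = Merlin_to_choose G \<Longrightarrow> v \<in> G \<Longrightarrow>
      forces_with (\<sigma> m F) g \<alpha> m F (vs @ [v])"
    if "forces_with (\<sigma> m F) g \<alpha> m F vs" for m F vs G v
    using that
  proof (atomize (full), cases rule: forces_with.cases)
    case (final u)
    then show "status_after g \<alpha> \<nu> m F vs \<noteq> Lost \<and> (status_after g \<alpha> \<nu> m F vs = Merlin_to_choose G \<longrightarrow>
        v \<in> G \<longrightarrow> forces_with (\<sigma> m F) g \<alpha> m F (vs @ [v]))"
      by (simp add: status_after_def)
  next
    case (ask n)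
    then have "status_after g \<alpha> \<nu> m F vs = (if \<sigma> m F vs = {} then Won else Merlin_to_choose (\<sigma> m F vs))"
      by (simp add: status_after_def \<nu>_def)
    then show "status_after g \<alpha> \<nu> m F vs \<noteq> Lost \<and> (status_after g \<alpha> \<nu> m F vs = Merlin_to_choose G \<longrightarrow>
        v \<in> G \<longrightarrow> forces_with (\<sigma> m F) g \<alpha> m F (vs @ [v]))"
      using ask(3)[of v] by (simp split: if_splits)
  qed
  have legal: "forces_with (\<sigma> m F) g \<alpha> m F vs" if "legal_play g \<alpha> \<nu> m F vs" "F \<in> f m" for m F vs
    using that by induction (auto intro: \<sigma> status)
  \<comment> \<open>Along a play that follows \<open>\<sigma>\<close>, each move descends in the derivation of \<^const>\<open>forces_with\<close>.\<close>
  have no_infinite_play: False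
    if "forces_with (\<sigma> m F) g \<alpha> m F vs" "vs = map w [0..<k]"
      "\<forall>k. legal_play g \<alpha> \<nu> m F (map w [0..<k])" for m F vs w k
    using that
  proof (induction arbitrary: k)
    case (final vs u)
    from final.prems(2)[rule_format, of "Suc k"] show ?case
      by cases (use final in \<open>auto simp: status_after_def split: if_splits\<close>)
  next
    case (ask vs n)
    from ask.prems(2)[rule_format, of "Suc k"] have "w k \<in> \<sigma> m F vs"
      by cases (use ask.hyps ask.prems(1) in \<open>auto simp: status_after_def \<nu>_def Let_def split: if_splits\<close>)
    then show ?case
      using ask.IH[of "w k" "Suc k"] ask.prems by simp
  qed
  have "winning f g \<alpha> \<nu>"
    unfolding winning_def
  proof (intro allI ballI conjI impI notI)
    fix m F vs
    assume "F \<in> f m" "legal_play g \<alpha> \<nu> m F vs" "status_after g \<alpha> \<nu> m F vs = Lost"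
    then show False using legal status(1) by blast
  next
    fix m F
    assume F: "F \<in> f m" and "\<exists>w. \<forall>k. legal_play g \<alpha> \<nu> m F (map w [0..<k])"
    then obtain w where w: "\<forall>k. legal_play g \<alpha> \<nu> m F (map w [0..<k])" by blast
    show False using no_infinite_play[OF \<sigma>[OF F], of w 0] w by simp
  qed
  then show ?thesis by blast
qed

text \<open>From here on Nimue does not appear any more.\<close>

lemma T3_reducible_iff_forces:
  "T3_reducible f g \<longleftrightarrow>
    (\<exists>\<alpha>. arthur_computable \<alpha> \<and> (\<forall>m. \<forall>F\<in>f m. forces g \<alpha> m F []))"
  unfolding T3_reducible_def using winning_imp_forces forces_imp_winning by meson

lemma arthur_plays_iff:
  "arthur_plays \<alpha> m vs = Some (Declare u) \<longleftrightarrow> \<alpha> m vs = Some \<langle>0, u\<rangle>"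
  "arthur_plays \<alpha> m vs = Some (Query n) \<longleftrightarrow> \<alpha> m vs = Some \<langle>1, n\<rangle>"
proof -
  have "decode_move c = Some (Declare u) \<longleftrightarrow> prod_decode c = (0, u)"
    "decode_move c = Some (Query n) \<longleftrightarrow> prod_decode c = (1, n)" for c
    by (auto simp: decode_move_def split: prod.splits if_splits)
  moreover have "prod_decode c = x \<longleftrightarrow> c = prod_encode x" for c x
    by auto
  ultimately show "arthur_plays \<alpha> m vs = Some (Declare u) \<longleftrightarrow> \<alpha> m vs = Some \<langle>0, u\<rangle>"
    "arthur_plays \<alpha> m vs = Some (Query n) \<longleftrightarrow> \<alpha> m vs = Some \<langle>1, n\<rangle>"
    by (auto simp: arthur_plays_def bind_eq_Some_conv)
qed

lemma T3_reducibleI: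
  assumes p: "partial_recursive p" and "\<And>m F. F \<in> f m \<Longrightarrow>
    forces g (\<lambda>m vs. p \<langle>m, list_encode vs\<rangle>) m F []"
  shows "T3_reducible f g"
  unfolding T3_reducible_iff_forces arthur_computable_def
  using assms by (intro exI[of _ "\<lambda>m vs. p \<langle>m, list_encode vs\<rangle>"]) blast

lemma T3_reducibleE:
  assumes "T3_reducible f g"
  obtains p where "partial_recursive p" and
    "\<And>m F. F \<in> f m \<Longrightarrow> forces g (\<lambda>m vs. p \<langle>m, list_encode vs\<rangle>) m F []"
proof -
  obtain \<alpha> p where \<alpha>: "\<forall>m. \<forall>F\<in>f m. forces g \<alpha> m F []" and p: "partial_recursive p"
    and "\<forall>m vs. \<alpha> m vs = p \<langle>m, list_encode vs\<rangle>"
    using assms unfolding T3_reducible_iff_forces arthur_computable_def by blast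
  then have "\<alpha> = (\<lambda>m vs. p \<langle>m, list_encode vs\<rangle>)" by blast
  with \<alpha> p that show ?thesis by blast
qed

text \<open>If \<open>p\<close> computes a query and \<open>q\<close> turns every answer to it into a solution, Arthur can stop after
  one round. Reflexivity and both lower bound properties of the meet are of this kind.\<close>

lemma one_query_reduction:
  assumes p: "partial_recursive p" and q: "recursive q"
    and pq: "\<And>m F. F \<in> f m \<Longrightarrow> \<exists>n. p m = Some n \<and> (\<exists>G\<in>g n. \<forall>v\<in>G. q v \<in> F)"
  shows "T3_reducible f g"
proof (rule T3_reducibleI)
  let ?p = "\<lambda>x. if code_snd x = 0 then Option.bind (p (code_fst x)) (\<lambda>n. Some \<langle>1, n\<rangle>)
    else Some \<langle>0, q (code_hd (code_snd x))\<rangle>"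
  show "partial_recursive ?p"
    by (intro recursive_intros partial_recursive_comp[OF p] recursive_comp[OF q])
  fix m F
  assume "F \<in> f m"
  then obtain n G where n: "p m = Some n" and G: "G \<in> g n" "\<And>v. v \<in> G \<Longrightarrow> q v \<in> F"
    using pq by blast
  show "forces g (\<lambda>m vs. ?p \<langle>m, list_encode vs\<rangle>) m F []"
  proof (rule forces.ask)
    show "arthur_plays (\<lambda>m vs. ?p \<langle>m, list_encode vs\<rangle>) m [] = Some (Query n)"
      by (simp add: arthur_plays_iff n)
    show "G \<in> g n" by fact
    fix v
    assume "v \<in> G"
    then show "forces g (\<lambda>m vs. ?p \<langle>m, list_encode vs\<rangle>) m F ([] @ [v])"
      by (intro forces.final[where u = "q v"]) (simp_all add: arthur_plays_iff G)
  qed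
qed

lemma T3_reducible_refl: "T3_reducible f f"
  by (rule one_query_reduction[where p = Some and q = "\<lambda>v. v"])
     (auto intro: recursive_intros)

section \<open>Replaying Merlin's moves\<close>

text \<open>A strategy for a combined game reads Merlin's moves from left to right. Its state consists of the
  initial number, the moves seen so far in each of two component games, and the moves not yet read;
  the leading \<open>1\<close> says that the computation goes on.\<close>

definition configuration :: "nat \<Rightarrow> nat list \<Rightarrow> nat list \<Rightarrow> nat list \<Rightarrow> nat" where
  "configuration m us ws rest =
    \<langle>1, \<langle>m, \<langle>list_encode us, \<langle>list_encode ws, list_encode rest\<rangle>\<rangle>\<rangle>\<rangle>"

definition replay :: "(nat \<rightharpoonup> nat) \<Rightarrow> nat \<rightharpoonup> nat" where
  "replay s x = run s \<langle>1, \<langle>code_fst x, \<langle>0, \<langle>0, code_snd x\<rangle>\<rangle>\<rangle>\<rangle>"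

lemma partial_recursive_replay: "partial_recursive s \<Longrightarrow> partial_recursive (replay s)"
  unfolding replay_def[abs_def]
  by (intro partial_recursive_comp[OF partial_recursive_run] recursive_intros)

text \<open>Having read \<open>vs\<close>, the program arrives at the component positions \<open>us\<close> and \<open>ws\<close>. Quantifying over the
  moves still to come makes this an invariant that is preserved when Merlin moves, although the
  strategy starts its computation afresh at each turn.\<close>

definition reaches :: "(nat \<rightharpoonup> nat) \<Rightarrow> nat \<Rightarrow> nat list \<Rightarrow> nat list \<Rightarrow> nat list \<Rightarrow> bool" where
  "reaches s m vs us ws \<longleftrightarrow>
    (\<forall>rest. replay s \<langle>m, list_encode (vs @ rest)\<rangle> = run s (configuration m us ws rest))"

lemma reaches_start: "reaches s m [] [] []"
  by (simp add: reaches_def replay_def configuration_def)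

lemma run_configuration:
  "run s (configuration m us ws rest) = Option.bind (s (configuration m us ws rest)) (run s)"
  by (rule run_step) (simp add: configuration_def)

lemma reaches_step:
  assumes "reaches s m vs us ws"
    and "\<And>rest. s (configuration m us ws (new @ rest)) = Some (configuration m us' ws' rest)"
  shows "reaches s m (vs @ new) us' ws'"
  using assms by (simp add: reaches_def run_configuration)

lemma replay_move:
  assumes "reaches s m vs us ws" and "s (configuration m us ws []) = Some \<langle>0, c\<rangle>"
  shows "replay s \<langle>m, list_encode vs\<rangle> = Some c"
  using assms(1)[unfolded reaches_def, rule_format, of "[]"] assms(2)
  by (simp add: run_configuration)

section \<open>Transitivity\<close>

text \<open>In a configuration, \<open>us\<close> is the position of the game of \<open>f\<close> to \<open>g\<close>, and \<open>ws\<close> the position of the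
  inner game which answers the query pending there. A value declared in the inner game is appended
  to \<open>us\<close> as if Merlin had played it, without reading one of Merlin's real moves, and a new inner game
  begins. There is no bound on the number of inner games that pass like this between two real moves,
  which is why an unbounded loop is needed. The two inductions follow the positions of the inner
  and of the outer game.\<close>

lemma T3_reducible_trans:
  assumes fg: "T3_reducible f g" and gh: "T3_reducible g h"
  shows "T3_reducible f h"
proof -
  obtain p where p: "partial_recursive p"
    and fp: "\<And>m F. F \<in> f m \<Longrightarrow> forces g (\<lambda>m vs. p \<langle>m, list_encode vs\<rangle>) m F []"
    using T3_reducibleE[OF fg] by metis
  obtain q where q: "partial_recursive q"
    and gq: "\<And>n G. G \<in> g n \<Longrightarrow> forces h (\<lambda>m vs. q \<langle>m, list_encode vs\<rangle>) n G []"
    using T3_reducibleE[OF gh] by metis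
  \<comment> \<open>\<open>\<langle>0, c\<rangle>\<close> stops the loop with Arthur's move \<open>c\<close>, which itself is a declaration if its first
    component is \<open>0\<close>.\<close>
  define s where "s x = (let m = code_fst (code_snd x); us = code_fst (code_snd (code_snd x));
        ws = code_fst (code_snd (code_snd (code_snd x)));
        rest = code_snd (code_snd (code_snd (code_snd x)))
      in Option.bind (p \<langle>m, us\<rangle>) (\<lambda>c.
        if code_fst c = 0 then Some \<langle>0, c\<rangle>
        else Option.bind (q \<langle>code_snd c, ws\<rangle>) (\<lambda>d.
          if code_fst d = 0 then Some \<langle>1, \<langle>m, \<langle>code_snoc us (code_snd d), \<langle>0, rest\<rangle>\<rangle>\<rangle>\<rangle>
          else if rest = 0 then Some \<langle>0, d\<rangle>
          else Some \<langle>1, \<langle>m, \<langle>us, \<langle>code_snoc ws (code_hd rest), code_tl rest\<rangle>\<rangle>\<rangle>\<rangle>)))" for x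
  have s: "s (configuration m us ws rest) = Option.bind (p \<langle>m, list_encode us\<rangle>) (\<lambda>c.
        if code_fst c = 0 then Some \<langle>0, c\<rangle>
        else Option.bind (q \<langle>code_snd c, list_encode ws\<rangle>) (\<lambda>d.
          if code_fst d = 0 then Some (configuration m (us @ [code_snd d]) [] rest)
          else case rest of [] \<Rightarrow> Some \<langle>0, d\<rangle> | v # vs \<Rightarrow> Some (configuration m us (ws @ [v]) vs)))"
    for m us ws rest
    by (cases rest) (simp_all add: s_def Let_def configuration_def code_snoc_def cong: if_cong)
  have s_rec: "partial_recursive s"
    unfolding s_def[abs_def] Let_def
    by (intro recursive_intros partial_recursive_comp[OF p] partial_recursive_comp[OF q]
        recursive_code_snoc)
  let ?\<alpha> = "\<lambda>m vs. replay s \<langle>m, list_encode vs\<rangle>"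
  \<comment> \<open>The last assumption is what remains to be shown of the outer game: it is won once the inner
    game has delivered an element of \<open>G\<close>.\<close>
  have inner: "forces h ?\<alpha> m F vs"
    if "forces h (\<lambda>m vs. q \<langle>m, list_encode vs\<rangle>) n G ws" "reaches s m vs us ws"
      and pn: "p \<langle>m, list_encode us\<rangle> = Some \<langle>1, n\<rangle>"
      and G: "\<And>w vs. w \<in> G \<Longrightarrow> reaches s m vs (us @ [w]) [] \<Longrightarrow> forces h ?\<alpha> m F vs"
    for m F n G us ws vs
    using that(1,2)
  proof (induction arbitrary: vs)
    case (final ws w)
    have "reaches s m (vs @ []) (us @ [w]) []"
      using final by (intro reaches_step[OF final.prems]) (simp add: s pn arthur_plays_iff)
    then show ?case using G final.hyps by simp
  next
    case (ask ws k H)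
    show ?case
    proof (rule forces.ask)
      show "arthur_plays ?\<alpha> m vs = Some (Query k)"
        using ask.hyps ask.prems unfolding arthur_plays_iff
        by (intro replay_move[OF ask.prems]) (simp add: s pn)
      show "H \<in> h k" by fact
      fix v
      assume "v \<in> H"
      moreover have "reaches s m (vs @ [v]) us (ws @ [v])"
        using ask.hyps by (intro reaches_step[OF ask.prems]) (simp add: s pn arthur_plays_iff)
      ultimately show "forces h ?\<alpha> m F (vs @ [v])" by (rule ask.IH)
    qed
  qed
  have outer: "forces h ?\<alpha> m F vs"
    if "forces g (\<lambda>m vs. p \<langle>m, list_encode vs\<rangle>) m F us" "reaches s m vs us []" for m F us vs
    using that
  proof (induction arbitrary: vs)
    case (final us u)
    show ?case
    proof (rule forces.final)
      show "arthur_plays ?\<alpha> m vs = Some (Declare u)"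
        using final.hyps unfolding arthur_plays_iff
        by (intro replay_move[OF final.prems]) (simp add: s)
    qed fact
  next
    case (ask us n G)
    show ?case
    proof (rule inner[OF gq ask.prems])
      show "G \<in> g n" by fact
      show "p \<langle>m, list_encode us\<rangle> = Some \<langle>1, n\<rangle>"
        using ask.hyps(1) unfolding arthur_plays_iff .
    qed (rule ask.IH)
  qed
  show ?thesis
    by (rule T3_reducibleI[OF partial_recursive_replay[OF s_rec]])
       (rule outer[OF fp reaches_start])
qed

section \<open>Meets of oracles\<close>

lemma meet_T3_lower:
  assumes inj: "inj (\<lambda>(m, n). pr m n)" and comp: "computable2 pr"
  shows "T3_reducible (meet_T3 pr f g) f" and "T3_reducible (meet_T3 pr f g) g"
proof -
  obtain p where p: "partial_recursive p" "\<And>m n. p (pr m n) = Some \<langle>m, n\<rangle>"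
    using unpairing[OF inj comp] by metis
  have k: "\<exists>m n U V. p k = Some \<langle>m, n\<rangle> \<and> F = tagged_union pr U V \<and> U \<in> f m \<and> V \<in> g n"
    if "F \<in> meet_T3 pr f g k" for k F
    using that p(2) by (auto simp: meet_T3_def)
  show "T3_reducible (meet_T3 pr f g) f"
  proof (rule one_query_reduction)
    show "partial_recursive (\<lambda>k. Option.bind (p k) (\<lambda>x. Some (code_fst x)))"
      by (intro recursive_intros p)
    show "recursive (\<lambda>u. pr 0 u)"
      by (intro recursive_computable2[OF comp] recursive_intros)
    fix k F
    assume "F \<in> meet_T3 pr f g k"
    from k[OF this] obtain m n U V where
      "p k = Some \<langle>m, n\<rangle>" "F = tagged_union pr U V" "U \<in> f m" "V \<in> g n" by blast
    then show "\<exists>n. Option.bind (p k) (\<lambda>x. Some (code_fst x)) = Some n \<and> (\<exists>G\<in>f n. \<forall>v\<in>G. pr 0 v \<in> F)"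
      by (auto simp: tagged_union_def intro!: bexI[of _ U])
  qed
  show "T3_reducible (meet_T3 pr f g) g"
  proof (rule one_query_reduction)
    show "partial_recursive (\<lambda>k. Option.bind (p k) (\<lambda>x. Some (code_snd x)))"
      by (intro recursive_intros p)
    show "recursive (\<lambda>v. pr 1 v)"
      by (intro recursive_computable2[OF comp] recursive_intros)
    fix k F
    assume "F \<in> meet_T3 pr f g k"
    from k[OF this] obtain m n U V where
      "p k = Some \<langle>m, n\<rangle>" "F = tagged_union pr U V" "U \<in> f m" "V \<in> g n" by blast
    then show "\<exists>n. Option.bind (p k) (\<lambda>x. Some (code_snd x)) = Some n \<and> (\<exists>G\<in>g n. \<forall>v\<in>G. pr 1 v \<in> F)"
      by (auto simp: tagged_union_def intro!: bexI[of _ V])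
  qed
qed

text \<open>The simultaneous play. The tag of a move read by the program decides which of the two positions it
  extends; when all moves have been read, both strategies are consulted, and a declaration by either
  of them is passed on. Induction over the position in the game to \<open>f\<close>, and inside it over the
  position in the game to \<open>g\<close>.\<close>

lemma meet_T3_greatest:
  assumes inj: "inj (\<lambda>(m, n). pr m n)" and comp: "computable2 pr"
    and hf: "T3_reducible h f" and hg: "T3_reducible h g"
  shows "T3_reducible h (meet_T3 pr f g)"
proof -
  obtain p where p: "partial_recursive p"
    and hp: "\<And>m F. F \<in> h m \<Longrightarrow> forces f (\<lambda>m vs. p \<langle>m, list_encode vs\<rangle>) m F []"
    using T3_reducibleE[OF hf] by metis
  obtain q where q: "partial_recursive q"
    and hq: "\<And>m F. F \<in> h m \<Longrightarrow> forces g (\<lambda>m vs. q \<langle>m, list_encode vs\<rangle>) m F []"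
    using T3_reducibleE[OF hg] by metis
  obtain r where r: "partial_recursive r" "\<And>m n. r (pr m n) = Some \<langle>m, n\<rangle>"
    using unpairing[OF inj comp] by metis
  define s where "s x = (let m = code_fst (code_snd x); us = code_fst (code_snd (code_snd x));
        ws = code_fst (code_snd (code_snd (code_snd x)));
        rest = code_snd (code_snd (code_snd (code_snd x)))
      in if rest = 0 then
        Option.bind (p \<langle>m, us\<rangle>) (\<lambda>c. if code_fst c = 0 then Some \<langle>0, c\<rangle>
          else Option.bind (q \<langle>m, ws\<rangle>) (\<lambda>d. if code_fst d = 0 then Some \<langle>0, d\<rangle>
            else Some \<langle>0, \<langle>1, pr (code_snd c) (code_snd d)\<rangle>\<rangle>))
      else Option.bind (r (code_hd rest)) (\<lambda>v. if code_fst v = 0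
        then Some \<langle>1, \<langle>m, \<langle>code_snoc us (code_snd v), \<langle>ws, code_tl rest\<rangle>\<rangle>\<rangle>\<rangle>
        else Some \<langle>1, \<langle>m, \<langle>us, \<langle>code_snoc ws (code_snd v), code_tl rest\<rangle>\<rangle>\<rangle>\<rangle>))" for x
  have s_move: "s (configuration m us ws []) =
        Option.bind (p \<langle>m, list_encode us\<rangle>) (\<lambda>c. if code_fst c = 0 then Some \<langle>0, c\<rangle>
          else Option.bind (q \<langle>m, list_encode ws\<rangle>) (\<lambda>d. if code_fst d = 0 then Some \<langle>0, d\<rangle>
            else Some \<langle>0, \<langle>1, pr (code_snd c) (code_snd d)\<rangle>\<rangle>))"
    and s_left: "s (configuration m us ws ([pr 0 u] @ rest)) = Some (configuration m (us @ [u]) ws rest)"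
    and s_right: "s (configuration m us ws ([pr 1 u] @ rest)) = Some (configuration m us (ws @ [u]) rest)"
    for m us ws rest u
    by (simp_all add: s_def Let_def configuration_def code_snoc_def r(2) cong: if_cong)
  have s_rec: "partial_recursive s"
    unfolding s_def[abs_def] Let_def
    by (intro recursive_intros partial_recursive_comp[OF p] partial_recursive_comp[OF q]
        partial_recursive_comp[OF r(1)] recursive_code_snoc recursive_computable2[OF comp])
  let ?\<alpha> = "\<lambda>m vs. replay s \<langle>m, list_encode vs\<rangle>"
  have forces_meet: "forces (meet_T3 pr f g) ?\<alpha> m F vs"
    if "forces f (\<lambda>m vs. p \<langle>m, list_encode vs\<rangle>) m F us"
      "forces g (\<lambda>m vs. q \<langle>m, list_encode vs\<rangle>) m F ws" "reaches s m vs us ws"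
    for m F us ws vs
    using that
  proof (induction arbitrary: ws vs)
    case (final us u)
    show ?case
    proof (rule forces.final)
      show "arthur_plays ?\<alpha> m vs = Some (Declare u)"
        using final.hyps unfolding arthur_plays_iff
        by (intro replay_move[OF final.prems(2)]) (simp add: s_move)
    qed fact
  next
    case (ask us n U)
    note left_hyps = ask.hyps and left_IH = ask.IH
    show ?case
      using ask.prems
    proof (induction arbitrary: vs)
      case (final ws u)
      show ?case
      proof (rule forces.final)
        show "arthur_plays ?\<alpha> m vs = Some (Declare u)"
          using final.hyps left_hyps unfolding arthur_plays_iff
          by (intro replay_move[OF final.prems]) (simp add: s_move)
      qed fact
    next
      case (ask ws k V)
      \<comment> \<open>If Merlin advances the game to \<open>f\<close>, the game to \<open>g\<close> is still at this very position.\<close>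
      have ws: "forces g (\<lambda>m vs. q \<langle>m, list_encode vs\<rangle>) m F ws"
        using ask.hyps by (rule forces.ask)
      show ?case
      proof (rule forces.ask)
        show "arthur_plays ?\<alpha> m vs = Some (Query (pr n k))"
          using ask.hyps left_hyps unfolding arthur_plays_iff
          by (intro replay_move[OF ask.prems]) (simp add: s_move)
        show "tagged_union pr U V \<in> meet_T3 pr f g (pr n k)"
          using ask.hyps left_hyps by (auto simp: meet_T3_def)
        fix v
        assume "v \<in> tagged_union pr U V"
        then consider u where "u \<in> U" "v = pr 0 u" | u where "u \<in> V" "v = pr 1 u"
          by (auto simp: tagged_union_def)
        then show "forces (meet_T3 pr f g) ?\<alpha> m F (vs @ [v])"
        proof cases
          case 1
          show ?thesis
            unfolding 1(2) by (rule left_IH[OF 1(1) ws reaches_step[OF ask.prems s_left]])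
        next
          case 2
          show ?thesis
            unfolding 2(2) by (rule ask.IH[OF 2(1) reaches_step[OF ask.prems s_right]])
        qed
      qed
    qed
  qed
  show ?thesis
    by (rule T3_reducibleI[OF partial_recursive_replay[OF s_rec]])
       (rule forces_meet[OF hp hq reaches_start])
qed

lemma meet_T3_of_T2:
  assumes "inj (\<lambda>(m, n). pr m n)"
  shows "meet_T3 pr (T3_of_T2 f) (T3_of_T2 g) = T3_of_T2 (meet_T2 pr f g)"
proof
  fix k
  show "meet_T3 pr (T3_of_T2 f) (T3_of_T2 g) k = T3_of_T2 (meet_T2 pr f g) k"
  proof (cases "k \<in> range (\<lambda>(m, n). pr m n)")
    case True
    then obtain m n where k: "k = pr m n" by auto
    have eq: "pr m n = pr m' n' \<longleftrightarrow> m = m' \<and> n = n'" for m' n'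
      using inj_eq[OF assms, of "(m, n)" "(m', n')"] by simp
    have "inv (\<lambda>(m, n). pr m n) k = (m, n)"
      using inv_f_f[OF assms, of "(m, n)"] by (simp add: k)
    with True show ?thesis
      by (auto simp: meet_T3_def meet_T2_def T3_of_T2_def k eq split: option.splits)
  next
    case False
    then show ?thesis
      by (auto simp: meet_T3_def meet_T2_def T3_of_T2_def)
  qed
qed

section \<open>Degrees\<close>

lemma equiv_T3_equiv: "equiv UNIV T3_equiv"
  by (rule equivI)
     (auto simp: T3_equiv_def refl_on_def sym_def trans_def intro: T3_reducible_refl T3_reducible_trans)

lemma T3_degree_eq_iff: "T3_degree f = T3_degree g \<longleftrightarrow> T3_reducible f g \<and> T3_reducible g f"
  unfolding T3_degree_def using eq_equiv_class_iff[OF equiv_T3_equiv, of f g]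
  by (simp add: T3_equiv_def)

lemma degree_le_iff: "degree_le (T3_degree f) (T3_degree g) \<longleftrightarrow> T3_reducible f g"
  unfolding degree_le_def T3_degree_def T3_equiv_def
  using T3_reducible_refl T3_reducible_trans by blast

text \<open>The set \<open>A\<close> of representatives makes both kinds of degrees instances of one statement: \<^term>\<open>A\<close> may be the set
  of all oracles or the set of the images of the T2 oracles.\<close>

lemma degrees_lower_semilattice:
  fixes A :: "T3_oracle set"
  defines "L \<equiv> \<lparr>carrier = T3_degree ` A, eq = (=), le = degree_le\<rparr>"
  assumes pr: "inj (\<lambda>(m, n). pr m n)" "computable2 pr"
    and closed: "\<And>f g. f \<in> A \<Longrightarrow> g \<in> A \<Longrightarrow> meet_T3 pr f g \<in> A"
  shows "lower_semilattice L"
    and "f \<in> A \<Longrightarrow> g \<in> A \<Longrightarrow> T3_degree f \<sqinter>\<^bsub>L\<^esub> T3_degree g = T3_degree (meet_T3 pr f g)"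
proof -
  interpret partial_order L
    by (unfold_locales; clarsimp simp: L_def degree_le_iff T3_degree_eq_iff;
        blast intro: T3_reducible_refl T3_reducible_trans)
  have greatest: "greatest L (T3_degree (meet_T3 pr f g)) (Lower L {T3_degree f, T3_degree g})"
    if "f \<in> A" "g \<in> A" for f g
    using that closed meet_T3_lower[OF pr] meet_T3_greatest[OF pr]
    by (auto simp: L_def greatest_def Lower_def degree_le_iff)
  show "lower_semilattice L"
    by unfold_locales (use greatest in \<open>auto simp: L_def\<close>)
  show "T3_degree f \<sqinter>\<^bsub>L\<^esub> T3_degree g = T3_degree (meet_T3 pr f g)" if "f \<in> A" "g \<in> A"
    unfolding meet_def inf_def
    using greatest[OF that] by (rule some_equality) (rule greatest_unique[OF _ greatest[OF that]])
qed

theorem proposition3p8: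
  fixes pr :: "nat \<Rightarrow> nat \<Rightarrow> nat"
  assumes "inj (\<lambda>(m, n). pr m n)" and "computable2 pr"
  shows "lower_semilattice D_T2 \<and> lower_semilattice D_T3 \<and>
    (\<forall>x \<in> carrier D_T2. \<forall>y \<in> carrier D_T2. x \<sqinter>\<^bsub>D_T2\<^esub> y = x \<sqinter>\<^bsub>D_T3\<^esub> y) \<and>
    (\<forall>f g :: T2_oracle. T2_degree f \<sqinter>\<^bsub>D_T2\<^esub> T2_degree g = T2_degree (meet_T2 pr f g)) \<and>
    (\<forall>f g :: T3_oracle. T3_degree f \<sqinter>\<^bsub>D_T3\<^esub> T3_degree g = T3_degree (meet_T3 pr f g))"
proof -
  have D3: "D_T3 = \<lparr>carrier = T3_degree ` UNIV, eq = (=), le = degree_le\<rparr>"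
    by (auto simp: D_T3_def quotient_def T3_degree_def)
  have D2: "D_T2 = \<lparr>carrier = T3_degree ` range T3_of_T2, eq = (=), le = degree_le\<rparr>"
    by (auto simp: D_T2_def T2_degree_def)
  have closed: "meet_T3 pr f g \<in> range T3_of_T2" if "f \<in> range T3_of_T2" "g \<in> range T3_of_T2" for f g
    using that meet_T3_of_T2[OF assms(1)] by auto
  note T3 = degrees_lower_semilattice[OF assms, of UNIV, folded D3, simplified]
  note T2 = degrees_lower_semilattice[OF assms closed, folded D2]
  have meet2: "T2_degree f \<sqinter>\<^bsub>D_T2\<^esub> T2_degree g = T2_degree (meet_T2 pr f g)" for f g
    using T2(2)[of "T3_of_T2 f" "T3_of_T2 g"]
    by (simp add: T2_degree_def meet_T3_of_T2[OF assms(1)])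
  have meet3: "T2_degree f \<sqinter>\<^bsub>D_T3\<^esub> T2_degree g = T2_degree (meet_T2 pr f g)" for f g
    by (simp add: T2_degree_def T3(2) meet_T3_of_T2[OF assms(1)])
  show ?thesis
    using T2(1) T3 meet2 meet3 by (auto simp: D_T2_def)
qed

end
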